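(* Consider the TSTMR iteration (defined in the context) for $Ax=b$, and let $k\ge 1$. Suppose that the vectors $\delta^{(k)}_1$ and $\delta^{(k)}_2$ at the $k$th step are nonzero. If the matrix $W_A(\delta^{(k)}_1,\delta^{(k)}_2)$ is singular, then there exists a scalar $\nu$ such that $$x^*=(1-\nu)\,x^{(k)}+\nu\, x^{(k-1)}$$ is the exact solution of $Ax=b$.
   Context: Let $A\in\mathbb{R}^{n\times n}$ be nonsingular and $b\in\mathbb{R}^n$. Let $A=\tilde M-\tilde N=\hat M-\hat N$ be two given splittings with $\tilde M,\hat M\in\mathbb{R}^{n\times n}$ nonsingular. $\langle\cdot,\cdot\rangle$ is the Euclidean inner product and $\|\cdot\|$ the Euclidean norm. For $x,y\in\mathbb{R}^n$ set $$W_A(x,y)=\begin{bmatrix}\langle Ax,Ax\rangle & \langle Ay,Ax\rangle\\ \langle Ax,Ay\rangle & \langle Ay,Ay\rangle\end{bmatrix}.$$ The TSTMR method. Given an arbitrary $x^{(0)}\in\mathbb{R}^n$, write $r^{(j)}=b-Ax^{(j)}$ and $r^{(j+\frac12)}=b-Ax^{(j+\frac12)}$ for residuals, and for all $j\ge 0$ set $\delta_1^{(j)}=\tilde M^{-1}r^{(j)}$, $\delta_1^{(j+\frac12)}=\hat M^{-1}r^{(j+\frac12)}$; for $j\ge1$ set $\delta_2^{(j)}=\delta_1^{(j)}-\delta_1^{(j-1)}$ and $\delta_2^{(j+\frac12)}=\delta_1^{(j+\frac12)}-\delta_1^{((j-1)+\frac12)}$. First step: $x^{(\frac12)}=x^{(0)}+\beta_0\delta_1^{(0)}$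 and $x^{(1)}=x^{(\frac12)}+\gamma_0\delta_1^{(\frac12)}$ with $$\beta_0=\frac{\langle r^{(0)},A\delta_1^{(0)}\rangle}{\|A\delta_1^{(0)}\|^2},\qquad \gamma_0=\frac{\langle r^{(\frac12)},A\delta_1^{(\frac12)}\rangle}{\|A\delta_1^{(\frac12)}\|^2}.$$ For $j\ge1$: $x^{(j+\frac12)}=x^{(j)}+\beta_1^{(j)}\delta_1^{(j)}+\beta_2^{(j)}\delta_2^{(j)}$ and $x^{(j+1)}=x^{(j+\frac12)}+\gamma_1^{(j)}\delta_1^{(j+\frac12)}+\gamma_2^{(j)}\delta_2^{(j+\frac12)}$, where the coefficients solve $$W_A(\delta_1^{(j)},\delta_2^{(j)})\begin{bmatrix}\beta_1^{(j)}\\ \beta_2^{(j)}\end{bmatrix}=\begin{bmatrix}\langle r^{(j)},A\delta_1^{(j)}\rangle\\ \langle r^{(j)},A\delta_2^{(j)}\rangle\end{bmatrix},\qquad W_A(\delta_1^{(j+\frac12)},\delta_2^{(j+\frac12)})\begin{bmatrix}\gamma_1^{(j)}\\ \gamma_2^{(j)}\end{bmatrix}=\begin{bmatrix}\langle r^{(j+\frac12)},A\delta_1^{(j+\frac12)}\rangle\\ \langle r^{(j+\frac12)},A\delta_2^{(j+\frac12)}\rangle\end{bmatrix}.$$ It is understood that the iteration has been carried out without breakdown (all denominators nonzero, all $2\times2$ matrices nonsingular) up to the computation of the iterates appearing in the statement. *)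

theory Defs
  imports "HOL-Analysis.Analysis"
begin

definition W_mat :: "real^'n^'n \<Rightarrow> real^'n \<Rightarrow> real^'n \<Rightarrow> real^2^2" where
  "W_mat A x y = vector [vector [(A *v x) \<bullet> (A *v x), (A *v y) \<bullet> (A *v x)],
                         vector [(A *v x) \<bullet> (A *v y), (A *v y) \<bullet> (A *v y)]]"

definition residual :: "real^'n^'n \<Rightarrow> real^'n \<Rightarrow> real^'n \<Rightarrow> real^'n" where
  "residual A b x = b - A *v x"

text \<open>The integer iterates \<open>x^(j)\<close> and the half-step iterates \<open>x^(j+1/2)\<close> are kept in two separate
  sequences \<open>x\<close> and \<open>xh\<close>, both indexed by \<open>j\<close>. The functions below serve for both families of
  corrections: with \<open>Mt\<close> and \<open>x\<close> they give \<open>\<delta>_i^(j)\<close>, with \<open>Mh\<close> and \<open>xh\<close> they give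
  \<open>\<delta>_i^(j+1/2)\<close>, where \<open>Mt\<close> and \<open>Mh\<close> are the matrices of the first and second splitting.\<close>

definition delta1 ::
    "real^'n^'n \<Rightarrow> real^'n \<Rightarrow> real^'n^'n \<Rightarrow> (nat \<Rightarrow> real^'n) \<Rightarrow> nat \<Rightarrow> real^'n" where
  "delta1 A b M x j = matrix_inv M *v residual A b (x j)"

text \<open>Only meaningful for \<open>j \<ge> 1\<close>, because of the truncated subtraction.\<close>

definition delta2 ::
    "real^'n^'n \<Rightarrow> real^'n \<Rightarrow> real^'n^'n \<Rightarrow> (nat \<Rightarrow> real^'n) \<Rightarrow> nat \<Rightarrow> real^'n" where
  "delta2 A b M x j = delta1 A b M x j - delta1 A b M x (j - 1)"

text \<open>\<open>y\<close> arises from \<open>x\<close> by a correction along \<open>d\<close>, respectively along \<open>d1\<close> and \<open>d2\<close>. Both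
  relations include the absence of breakdown, and then determine \<open>y\<close> uniquely.\<close>

definition one_dir_update ::
    "real^'n^'n \<Rightarrow> real^'n \<Rightarrow> real^'n \<Rightarrow> real^'n \<Rightarrow> real^'n \<Rightarrow> bool" where
  "one_dir_update A b d x y \<longleftrightarrow>
     (norm (A *v d))\<^sup>2 \<noteq> 0 \<and>
     y = x + ((residual A b x \<bullet> (A *v d)) / (norm (A *v d))\<^sup>2) *\<^sub>R d"

definition two_dir_update ::
    "real^'n^'n \<Rightarrow> real^'n \<Rightarrow> real^'n \<Rightarrow> real^'n \<Rightarrow> real^'n \<Rightarrow> real^'n \<Rightarrow> bool" where
  "two_dir_update A b d1 d2 x y \<longleftrightarrow>
     invertible (W_mat A d1 d2) \<and>
     (\<exists>c :: real^2.
        W_mat A d1 d2 *v c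
          = vector [residual A b x \<bullet> (A *v d1), residual A b x \<bullet> (A *v d2)] \<and>
        y = x + (c $ 1) *\<^sub>R d1 + (c $ 2) *\<^sub>R d2)"

text \<open>\<open>tstmr_run A b Mt Mh k x xh\<close>: the TSTMR method, started at the arbitrary vector \<open>x 0\<close>, has been
  carried out without breakdown up to the computation of \<open>x^(k)\<close>, producing \<open>x 0, \<dots>, x k\<close> and
  \<open>xh 0, \<dots>, xh (k - 1)\<close>. Later entries of the two sequences are unconstrained.\<close>

definition tstmr_run ::
    "real^'n^'n \<Rightarrow> real^'n \<Rightarrow> real^'n^'n \<Rightarrow> real^'n^'n \<Rightarrow> nat
      \<Rightarrow> (nat \<Rightarrow> real^'n) \<Rightarrow> (nat \<Rightarrow> real^'n) \<Rightarrow> bool" where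
  "tstmr_run A b Mt Mh k x xh \<longleftrightarrow>
     (0 < k \<longrightarrow>
        one_dir_update A b (delta1 A b Mt x 0) (x 0) (xh 0) \<and>
        one_dir_update A b (delta1 A b Mh xh 0) (xh 0) (x 1)) \<and>
     (\<forall>j. 1 \<le> j \<and> j < k \<longrightarrow>
        two_dir_update A b (delta1 A b Mt x j) (delta2 A b Mt x j) (x j) (xh j) \<and>
        two_dir_update A b (delta1 A b Mh xh j) (delta2 A b Mh xh j) (xh j) (x (j + 1)))"

end

theory Submission
  imports Defs
begin

text \<open>\<open>W_A(x,y)\<close> is the Gram matrix of \<open>Ax\<close> and \<open>Ay\<close>, so by the equality case of the Cauchy--Schwarz
  inequality its singularity makes \<open>\<delta>\<^sub>1\<close> a multiple \<open>\<nu>\<delta>\<^sub>2\<close>. As \<open>\<delta>\<^sub>1\<close> and \<open>\<delta>\<^sub>2\<close> are the images of the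
  residual \<open>r\<^sup>(\<^sup>k\<^sup>)\<close> and of the residual difference \<open>r\<^sup>(\<^sup>k\<^sup>) - r\<^sup>(\<^sup>k\<^sup>-\<^sup>1\<^sup>)\<close> under an injective linear map,
  this says that the affine combination \<open>(1 - \<nu>)r\<^sup>(\<^sup>k\<^sup>) + \<nu>r\<^sup>(\<^sup>k\<^sup>-\<^sup>1\<^sup>)\<close>, which is the residual of
  \<open>(1 - \<nu>)x\<^sup>(\<^sup>k\<^sup>) + \<nu>x\<^sup>(\<^sup>k\<^sup>-\<^sup>1\<^sup>)\<close>, vanishes.\<close>

lemma det_W_mat:
  "det (W_mat A x y) = (norm (A *v x) * norm (A *v y))\<^sup>2 - ((A *v x) \<bullet> (A *v y))\<^sup>2"
  by (simp add: W_mat_def det_2 inner_commute power_mult_distrib power2_norm_eq_inner)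
    (simp add: power2_eq_square)

lemma matrix_vector_mult_eq_0_iff:
  fixes A :: "real^'n^'n"
  assumes "invertible A"
  shows "A *v x = 0 \<longleftrightarrow> x = 0"
  using assms by (metis invertible_left_inverse matrix_left_invertible_ker matrix_vector_mult_0_right)

lemma invertible_matrix_inv:
  assumes "invertible A"
  shows "invertible (matrix_inv A)"
proof -
  have "A ** matrix_inv A = mat 1 \<and> matrix_inv A ** A = mat 1"
    unfolding matrix_inv_def using assms unfolding invertible_def by (rule someI_ex)
  then show ?thesis
    unfolding invertible_def by blast
qed

lemma singular_W_mat_imp_parallel:
  fixes A :: "real^'n^'n"
  assumes A: "invertible A" and "y \<noteq> 0" and W: "\<not> invertible (W_mat A x y)"
  obtains c where "x = c *\<^sub>R y"
proof -
  have "((A *v x) \<bullet> (A *v y))\<^sup>2 = (norm (A *v x) * norm (A *v y))\<^sup>2"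
    using W by (simp add: invertible_det_nz det_W_mat)
  \<comment> \<open>The factors are swapped because \<open>collinear_lemma\<close> makes the last
    vector a multiple of the middle one.\<close>
  then have "\<bar>(A *v y) \<bullet> (A *v x)\<bar> = norm (A *v y) * norm (A *v x)"
    using power2_eq_iff_nonneg[of "\<bar>(A *v x) \<bullet> (A *v y)\<bar>" "norm (A *v x) * norm (A *v y)"]
    by (simp add: inner_commute mult.commute)
  then have "collinear {0, A *v y, A *v x}"
    by (simp add: norm_cauchy_schwarz_equal)
  \<comment> \<open>Excludes the one degenerate collinear case that may admit no \<open>c\<close>;
    if \<open>A *v x = 0\<close>, then \<open>c = 0\<close> serves.\<close>
  moreover have "A *v y \<noteq> 0"
    using matrix_vector_mult_eq_0_iff[OF A] \<open>y \<noteq> 0\<close> by simp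
  ultimately obtain c where "A *v x = c *\<^sub>R (A *v y)"
    unfolding collinear_lemma by (metis scaleR_zero_left)
  then have "A *v (x - c *\<^sub>R y) = 0"
    by (simp add: matrix_vector_mult_diff_distrib matrix_vector_mult_scaleR)
  then have "x = c *\<^sub>R y"
    using matrix_vector_mult_eq_0_iff[OF A] by simp
  then show thesis
    by (rule that)
qed

text \<open>The weights sum to 1, so \<open>b\<close> is kept. For \<open>x k\<close> and
  \<open>x (k - 1)\<close>, applying \<open>matrix_inv Mt\<close> to the right-hand side gives
  \<open>delta1\<close> minus \<open>c\<close> times \<open>delta2\<close>.\<close>

lemma residual_affine_combination:
  "residual A b ((1 - c) *\<^sub>R x + c *\<^sub>R y) = residual A b x - c *\<^sub>R (residual A b x - residual A b y)"
  by (simp add: residual_def matrix_vector_right_distrib matrix_vector_mult_scaleR algebra_simps)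

theorem proposition2p2:
  fixes A Mt Nt Mh Nh :: "real^'n^'n" and b :: "real^'n"
    and x xh :: "nat \<Rightarrow> real^'n" and k :: nat
  assumes "invertible A"
    and "A = Mt - Nt" and "invertible Mt"
    and "A = Mh - Nh" and "invertible Mh"
    and "k \<ge> 1"
    and "tstmr_run A b Mt Mh k x xh"
    and "delta1 A b Mt x k \<noteq> 0"
    and "delta2 A b Mt x k \<noteq> 0"
    and "\<not> invertible (W_mat A (delta1 A b Mt x k) (delta2 A b Mt x k))"
  shows "\<exists>\<nu>::real. A *v ((1 - \<nu>) *\<^sub>R x k + \<nu> *\<^sub>R x (k - 1)) = b"
proof -
  obtain \<nu> where "delta1 A b Mt x k = \<nu> *\<^sub>R delta2 A b Mt x k"
    using singular_W_mat_imp_parallel assms by metis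
  then have "matrix_inv Mt *v residual A b ((1 - \<nu>) *\<^sub>R x k + \<nu> *\<^sub>R x (k - 1)) = 0"
    by (simp add: residual_affine_combination delta1_def delta2_def
        matrix_vector_mult_diff_distrib matrix_vector_mult_scaleR)
  then have "residual A b ((1 - \<nu>) *\<^sub>R x k + \<nu> *\<^sub>R x (k - 1)) = 0"
    using matrix_vector_mult_eq_0_iff invertible_matrix_inv \<open>invertible Mt\<close> by blast
  then show ?thesis
    unfolding residual_def by (metis eq_iff_diff_eq_0)
qed

end
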